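(* For $d\ge1$ and $k\ge1$, the anisotropic set $\Psi^k_{ani}$ and the sparse set $\Psi^k$ satisfy $$\#\Psi^k_{ani}=6^d2^{dk}=\mathcal O(2^{dk}),\qquad\#\Psi^k=\mathcal O(2^kk^{d-1}).$$ More precisely, $$\#\Psi^k=6^2(k+2)2^{k+1}\ \text{ if }d=2,\qquad\#\Psi^k=6^3(k^2+7k+8)2^k\ \text{ if }d=3,$$ $$\#\Psi^k=6^4\Big(\frac{k^3}6+\frac{5k^2}2+\frac{28k}3+8\Big)2^{k+1}\ \text{ if }d=4,$$ $$\#\Psi^k=6^5\Big(\frac{k^4}{24}+\frac{13k^3}{12}+\frac{203k^2}{24}+\frac{269k}{12}+16\Big)2^{k+1}\ \text{ if }d=5.$$
   Context: $\#$ denotes cardinality. The univariate basis functions $\psi_{j,k}$ are indexed by levels $j\ge0$ and $k\in\mathcal J_j$, where $\mathcal J_0=\{-5,\dots,6\}$ (so $\#\mathcal J_0=12$: six scaling functions and six wavelets) and $\mathcal J_j=\{1,\dots,6\cdot2^j\}$ for $j\ge1$; they form an orthonormal system in $L^2(0,1)$, in particular they are pairwise distinct. For $\lambda=(\lambda_1,\dots,\lambda_d)$ with $\lambda_i=(j_i,k_i)$, $j_i\ge0$, $k_i\in\mathcal J_{j_i}$, put $|\lambda_i|=j_i$ and $\psi_\lambda(x)=\prod_{i=1}^d\psi_{\lambda_i}(x_i)$. Then $$\Psi^k=\Big\{\psi_\lambda:\sum_{i=1}^d|\lambda_i|\le k\Big\},\qquad\Psi^k_{ani}=\{\psi_\lambda:|\lambda_i|\le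 k,\ i=1,\dots,d\}.$$ The $\mathcal O$ statements are for $k\to\infty$ with $d$ fixed.
   Formalization: The printed count 6^d 2^{dk} of the anisotropic set is false (for d=1, k=1 the set has 12+12=24 elements, not 12); the formal statement proves the corrected value 6^d 2^{d(k+1)}. The bound O(2^{dk}) and all other formulas are unchanged. *)

theory Defs
  imports "HOL-Analysis.Analysis" "HOL-Library.Landau_Symbols"
begin

(* Level 0 carries six scaling functions and six wavelets. *)
definition wavelet_index :: "nat \<Rightarrow> int set" where
  "wavelet_index j = (if j = 0 then {-5..6} else {1..6 * 2 ^ j})"

definition in_L2_unit :: "(real \<Rightarrow> real) \<Rightarrow> bool" where
  "in_L2_unit f \<longleftrightarrow>
     f \<in> borel_measurable (lebesgue_on {0<..<1}) \<and>
     integrable (lebesgue_on {0<..<1}) (\<lambda>x. (f x)\<^sup>2)"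

definition inner_L2_unit :: "(real \<Rightarrow> real) \<Rightarrow> (real \<Rightarrow> real) \<Rightarrow> real" where
  "inner_L2_unit f g = (\<integral>x. f x * g x \<partial>lebesgue_on {0<..<1})"

definition orthonormal_wavelet_system :: "(nat \<Rightarrow> int \<Rightarrow> real \<Rightarrow> real) \<Rightarrow> bool" where
  "orthonormal_wavelet_system \<psi> \<longleftrightarrow>
     (\<forall>j. \<forall>k\<in>wavelet_index j. in_L2_unit (\<psi> j k)) \<and>
     (\<forall>i j. \<forall>k\<in>wavelet_index i. \<forall>l\<in>wavelet_index j.
        inner_L2_unit (\<psi> i k) (\<psi> j l) = (if i = j \<and> k = l then 1 else 0))"

definition unit_cube :: "(real ^ 'n) set" where
  "unit_cube = {x. \<forall>i. x $ i \<in> {0<..<1}}"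

(* A multi-index assigns to each coordinate a pair (level, position). *)
definition multi_indices :: "('n \<Rightarrow> nat \<times> int) set" where
  "multi_indices = {m. \<forall>i. snd (m i) \<in> wavelet_index (fst (m i))}"

(* restrict makes equality of tensor products mean equality on the open unit cube only. *)
definition tensor_wavelet ::
    "(nat \<Rightarrow> int \<Rightarrow> real \<Rightarrow> real) \<Rightarrow> ('n::finite \<Rightarrow> nat \<times> int) \<Rightarrow> real ^ 'n \<Rightarrow> real" where
  "tensor_wavelet \<psi> m =
     restrict (\<lambda>x. \<Prod>i\<in>UNIV. \<psi> (fst (m i)) (snd (m i)) (x $ i)) unit_cube"

definition sparse_set ::
    "(nat \<Rightarrow> int \<Rightarrow> real \<Rightarrow> real) \<Rightarrow> nat \<Rightarrow> (real ^ 'n::finite \<Rightarrow> real) set" where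
  "sparse_set \<psi> k =
     {tensor_wavelet \<psi> m | m. m \<in> multi_indices \<and> (\<Sum>i\<in>UNIV. fst (m i)) \<le> k}"

definition anisotropic_set ::
    "(nat \<Rightarrow> int \<Rightarrow> real \<Rightarrow> real) \<Rightarrow> nat \<Rightarrow> (real ^ 'n::finite \<Rightarrow> real) set" where
  "anisotropic_set \<psi> k =
     {tensor_wavelet \<psi> m | m. m \<in> multi_indices \<and> (\<forall>i. fst (m i) \<le> k)}"

end

theory Submission
  imports Defs
begin

text \<open>
  Distinct multi-indices give distinct tensor products: freezing all coordinates but one at points
  where the factors do not vanish would make two orthogonal unit vectors proportional. So the sets
  are counted by their multi-indices. Splitting off one coordinate turns the number of sparse
  multi-indices into a convolution of the level sizes \<open>12, 12, 24, 48, \<dots>\<close>. After division by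
  \<open>6^d * 2^k\<close> this convolution becomes \<open>p (d+1) k = p d k + (\<Sum>i\<le>k. p d i)\<close> with \<open>p 1 k = 2\<close>,
  hence \<open>p d\<close> is a polynomial of degree \<open>d - 1\<close> in \<open>k\<close>.
\<close>

section \<open>Injectivity of the tensor product map on multi-indices\<close>

lemma orthonormal_wavelet_system_nonzero:
  assumes "orthonormal_wavelet_system \<psi>" "k \<in> wavelet_index j"
  obtains t where "t \<in> {0<..<1}" "\<psi> j k t \<noteq> 0"
proof -
  have "\<exists>t\<in>{0<..<1}. \<psi> j k t \<noteq> 0"
  proof (rule ccontr)
    assume "\<not> ?thesis"
    then have "inner_L2_unit (\<psi> j k) (\<psi> j k) = (\<integral>x. 0 \<partial>lebesgue_on {0<..<1::real})"
      unfolding inner_L2_unit_def by (intro Bochner_Integration.integral_cong) auto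
    moreover have "inner_L2_unit (\<psi> j k) (\<psi> j k) = 1"
      using assms by (auto simp: orthonormal_wavelet_system_def)
    ultimately show False by simp
  qed
  then show ?thesis using that by blast
qed

text \<open>Pairing the proportionality with \<open>\<psi> j l\<close> turns \<open>c\<close> into
  an inner product of different members of the system, so \<open>c = 0\<close>; then
  \<open>\<psi> i k\<close> vanishes on the unit interval although its norm is 1.\<close>

lemma orthonormal_wavelet_system_not_proportional:
  assumes "orthonormal_wavelet_system \<psi>" "k \<in> wavelet_index i" "l \<in> wavelet_index j"
    and scaled: "\<And>t. t \<in> {0<..<1} \<Longrightarrow> \<psi> i k t = c * \<psi> j l t"
  shows "(i, k) = (j, l)"
proof (rule ccontr)
  assume ne: "(i, k) \<noteq> (j, l)"
  have "inner_L2_unit (\<psi> i k) (\<psi> j l) = (\<integral>x. c * (\<psi> j l x * \<psi> j l x) \<partial>lebesgue_on {0<..<1})"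
    unfolding inner_L2_unit_def by (intro Bochner_Integration.integral_cong) (auto simp: scaled)
  also have "\<dots> = c * inner_L2_unit (\<psi> j l) (\<psi> j l)"
    unfolding inner_L2_unit_def by simp
  finally have "c = 0"
    using assms(1-3) ne by (auto simp: orthonormal_wavelet_system_def)
  moreover obtain t where "t \<in> {0<..<1}" "\<psi> i k t \<noteq> 0"
    using orthonormal_wavelet_system_nonzero assms(1,2) by blast
  ultimately show False using scaled by auto
qed

lemma inj_on_tensor_wavelet:
  fixes \<psi> :: "nat \<Rightarrow> int \<Rightarrow> real \<Rightarrow> real"
  assumes orth: "orthonormal_wavelet_system \<psi>"
  shows "inj_on (tensor_wavelet \<psi> :: ('n::finite \<Rightarrow> nat \<times> int) \<Rightarrow> _) multi_indices"
proof (rule inj_onI, rule ext)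
  fix m m' :: "'n \<Rightarrow> nat \<times> int" and i
  assume m: "m \<in> multi_indices" and m': "m' \<in> multi_indices"
    and eq: "tensor_wavelet \<psi> m = tensor_wavelet \<psi> m'"
  define f where "f n = \<psi> (fst (m n)) (snd (m n))" for n
  define g where "g n = \<psi> (fst (m' n)) (snd (m' n))" for n
  have idx: "snd (m n) \<in> wavelet_index (fst (m n))" "snd (m' n) \<in> wavelet_index (fst (m' n))" for n
    using m m' by (auto simp: multi_indices_def)
  have "\<exists>t. t \<in> {0<..<1} \<and> f n t \<noteq> 0" for n
    unfolding f_def using orthonormal_wavelet_system_nonzero[OF orth idx(1)] by metis
  \<comment> \<open>Only the factors of \<open>m\<close> are kept nonzero at \<open>y\<close>. The
    factors of \<open>m'\<close> may vanish there, so \<open>c'\<close> may be 0, and only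
    \<open>c\<close> is divided by.\<close>
  then obtain y where y: "\<And>n. y n \<in> {0<..<1}" "\<And>n. f n (y n) \<noteq> 0" by metis
  define c where "c = (\<Prod>n\<in>UNIV - {i}. f n (y n))"
  define c' where "c' = (\<Prod>n\<in>UNIV - {i}. g n (y n))"
  have "c \<noteq> 0" using y by (simp add: c_def)
  have "f i t = (c' / c) * g i t" if t: "t \<in> {0<..<1}" for t
  proof -
    define x :: "real ^ 'n" where "x = (\<chi> n. if n = i then t else y n)"
    have "x \<in> unit_cube" using t y by (auto simp: unit_cube_def x_def)
    then have "(\<Prod>n\<in>UNIV. f n (x $ n)) = (\<Prod>n\<in>UNIV. g n (x $ n))"
      using fun_cong[OF eq, of x] by (simp add: tensor_wavelet_def f_def g_def)
    moreover have "(\<Prod>n\<in>UNIV. h n (x $ n)) = h i t * (\<Prod>n\<in>UNIV - {i}. h n (y n))"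
      for h :: "'n \<Rightarrow> real \<Rightarrow> real"
      by (simp add: prod.remove[of UNIV i] x_def)
    ultimately have "f i t * c = g i t * c'" by (simp add: c_def c'_def)
    with \<open>c \<noteq> 0\<close> show ?thesis by (simp add: field_simps)
  qed
  then have "(fst (m i), snd (m i)) = (fst (m' i), snd (m' i))"
    unfolding f_def g_def by (rule orthonormal_wavelet_system_not_proportional[OF orth idx])
  then show "m i = m' i" by simp
qed

section \<open>Level sizes and the anisotropic count\<close>

lemma finite_wavelet_index: "finite (wavelet_index j)"
  by (simp add: wavelet_index_def)

lemma card_wavelet_index: "card (wavelet_index j) = 6 * 2 ^ j + (if j = 0 then 6 else 0)"
  by (simp add: wavelet_index_def nat_mult_distrib nat_power_eq)

text \<open>The geometric sum \<open>6 * (2 ^ (k + 1) - 1)\<close> is completed to a pure power by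
  the six surplus functions of level 0.\<close>

lemma sum_card_wavelet_index: "(\<Sum>j\<le>k. card (wavelet_index j)) = 6 * 2 ^ (k + 1)"
  by (induction k) (simp_all add: card_wavelet_index)

lemma mem_Sigma_fst_snd: "p \<in> Sigma A B \<longleftrightarrow> fst p \<in> A \<and> snd p \<in> B (fst p)"
  by (cases p) auto

text \<open>The level bound acts on each coordinate separately, so the index set is a full Cartesian
  power and its size a power of \<open>6 * 2 ^ (k + 1)\<close>.\<close>

lemma anisotropic_indices_eq:
  "UNIV \<rightarrow>\<^sub>E Sigma {..k} wavelet_index = {m \<in> multi_indices. \<forall>i. fst (m i) \<le> k}"
  by (auto simp: multi_indices_def PiE_iff mem_Sigma_fst_snd)

lemma anisotropic_set_eq:
  "anisotropic_set \<psi> k = tensor_wavelet \<psi> ` (UNIV \<rightarrow>\<^sub>E Sigma {..k} wavelet_index)"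
  unfolding anisotropic_set_def anisotropic_indices_eq by blast

lemma finite_card_anisotropic_set:
  assumes "orthonormal_wavelet_system \<psi>"
  shows "finite (anisotropic_set \<psi> k :: (real ^ 'n::finite \<Rightarrow> real) set)"
    and "card (anisotropic_set \<psi> k :: (real ^ 'n \<Rightarrow> real) set)
      = 6 ^ CARD('n) * 2 ^ (CARD('n) * (k + 1))"
proof -
  let ?I = "UNIV \<rightarrow>\<^sub>E Sigma {..k} wavelet_index :: ('n \<Rightarrow> nat \<times> int) set"
  show "finite (anisotropic_set \<psi> k :: (real ^ 'n \<Rightarrow> real) set)"
    by (auto simp: anisotropic_set_eq finite_wavelet_index intro!: finite_PiE)
  have "?I \<subseteq> multi_indices"
    by (auto simp: anisotropic_indices_eq)
  then have "inj_on (tensor_wavelet \<psi>) ?I"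
    using inj_on_tensor_wavelet[OF assms] inj_on_subset by blast
  then have "card (anisotropic_set \<psi> k :: (real ^ 'n \<Rightarrow> real) set) = card ?I"
    by (simp add: anisotropic_set_eq card_image)
  also have "\<dots> = (6 * 2 ^ (k + 1)) ^ CARD('n)"
    by (simp add: card_PiE card_SigmaI finite_wavelet_index sum_card_wavelet_index)
  finally show "card (anisotropic_set \<psi> k :: (real ^ 'n \<Rightarrow> real) set)
      = 6 ^ CARD('n) * 2 ^ (CARD('n) * (k + 1))"
    by (simp only: power_mult_distrib mult.commute flip: power_mult)
qed

section \<open>Sparse multi-indices and their convolution recursion\<close>

text \<open>A variable coordinate set \<open>A\<close> in place of \<open>UNIV\<close> allows
  induction on the number of coordinates; \<open>PiE\<close> fixes the values outside
  \<open>A\<close>, which keeps the set finite.\<close>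

definition sparse_indices :: "'a set \<Rightarrow> nat \<Rightarrow> ('a \<Rightarrow> nat \<times> int) set" where
  "sparse_indices A k =
     {m \<in> A \<rightarrow>\<^sub>E Sigma UNIV wavelet_index. (\<Sum>i\<in>A. fst (m i)) \<le> k}"

fun sparse_count :: "nat \<Rightarrow> nat \<Rightarrow> nat" where
  "sparse_count 0 k = 1"
| "sparse_count (Suc d) k = (\<Sum>j\<le>k. card (wavelet_index j) * sparse_count d (k - j))"

text \<open>Choosing \<open>p\<close> at the new coordinate leaves the level budget
  \<open>k - fst p\<close> for the others. The truncated subtraction is harmless because
  \<open>p\<close> has level at most \<open>k\<close>.\<close>

lemma sparse_indices_insert:
  assumes "finite A" "a \<notin> A"
  shows "bij_betw (\<lambda>(p, m). m(a := p))
    (SIGMA p:Sigma {..k} wavelet_index. sparse_indices A (k - fst p))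
    (sparse_indices (insert a A) k)"
proof (rule bij_betw_byWitness[where f' = "\<lambda>m. (m a, restrict m A)"])
  have upd: "(\<Sum>i\<in>A. fst ((m(a := p)) i)) = (\<Sum>i\<in>A. fst (m i))"
    for m :: "'a \<Rightarrow> nat \<times> int" and p
    using assms(2) by (intro sum.cong) auto
  show "\<forall>x\<in>SIGMA p:Sigma {..k} wavelet_index. sparse_indices A (k - fst p).
      (\<lambda>m. (m a, restrict m A)) ((\<lambda>(p, m). m(a := p)) x) = x"
    using assms(2) by (auto simp: sparse_indices_def PiE_def extensional_def restrict_def)
  show "\<forall>m\<in>sparse_indices (insert a A) k.
      (\<lambda>(p, m). m(a := p)) ((\<lambda>m. (m a, restrict m A)) m) = m"
    by (auto simp: sparse_indices_def PiE_def extensional_def restrict_def)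
  show "(\<lambda>(p, m). m(a := p)) ` (SIGMA p:Sigma {..k} wavelet_index. sparse_indices A (k - fst p))
      \<subseteq> sparse_indices (insert a A) k"
    using assms upd by (auto simp: sparse_indices_def intro!: PiE_fun_upd)
  show "(\<lambda>m. (m a, restrict m A)) ` sparse_indices (insert a A) k
      \<subseteq> (SIGMA p:Sigma {..k} wavelet_index. sparse_indices A (k - fst p))"
    using assms by (fastforce simp: sparse_indices_def PiE_def Pi_def)
qed

lemma finite_card_sparse_indices:
  assumes "finite A"
  shows "finite (sparse_indices A k) \<and> card (sparse_indices A k) = sparse_count (card A) k"
  using assms
proof (induction A arbitrary: k rule: finite_induct)
  case empty
  then show ?case by (simp add: sparse_indices_def)
next
  case (insert a A)
  let ?P = "Sigma {..k} wavelet_index"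
  note bij = sparse_indices_insert[OF insert.hyps, of k]
  have finP: "finite ?P" by (simp add: finite_wavelet_index)
  have "finite (SIGMA p:?P. sparse_indices A (k - fst p))"
    using insert.IH finP by (intro finite_SigmaI[OF finP]) blast
  then have fin: "finite (sparse_indices (insert a A) k)"
    using bij_betw_finite[OF bij] by simp
  have "card (sparse_indices (insert a A) k)
      = card (SIGMA p:?P. sparse_indices A (k - fst p))"
    using bij_betw_same_card[OF bij] by simp
  also have "\<dots> = (\<Sum>p\<in>?P. sparse_count (card A) (k - fst p))"
    using insert.IH by (subst card_SigmaI[OF finP]) auto
  also have "\<dots> = (\<Sum>(j, l)\<in>?P. sparse_count (card A) (k - j))"
    by (simp add: case_prod_unfold)
  \<comment> \<open>The fibre size depends on the level of \<open>p\<close> alone, so summing over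
    positions only contributes the factor \<open>card (wavelet_index j)\<close>.\<close>
  also have "\<dots> = (\<Sum>j\<le>k. \<Sum>l\<in>wavelet_index j. sparse_count (card A) (k - j))"
    by (subst sum.Sigma) (auto simp: finite_wavelet_index)
  also have "\<dots> = sparse_count (card (insert a A)) k"
    using insert.hyps by simp
  finally show ?case using fin by simp
qed

lemma sparse_indices_UNIV:
  "sparse_indices UNIV k = {m \<in> multi_indices. (\<Sum>i\<in>UNIV. fst (m i)) \<le> k}"
  by (auto simp: sparse_indices_def multi_indices_def PiE_iff mem_Sigma_fst_snd)

lemma sparse_set_eq: "sparse_set \<psi> k = tensor_wavelet \<psi> ` sparse_indices UNIV k"
  unfolding sparse_set_def sparse_indices_UNIV by blast

lemma finite_card_sparse_set:
  assumes "orthonormal_wavelet_system \<psi>"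
  shows "finite (sparse_set \<psi> k :: (real ^ 'n::finite \<Rightarrow> real) set)"
    and "card (sparse_set \<psi> k :: (real ^ 'n \<Rightarrow> real) set) = sparse_count CARD('n) k"
proof -
  let ?I = "sparse_indices UNIV k :: ('n \<Rightarrow> nat \<times> int) set"
  have I: "finite ?I" "card ?I = sparse_count CARD('n) k"
    using finite_card_sparse_indices[of "UNIV :: 'n set" k] by auto
  then show "finite (sparse_set \<psi> k :: (real ^ 'n \<Rightarrow> real) set)"
    by (simp add: sparse_set_eq)
  have "?I \<subseteq> multi_indices"
    by (auto simp: sparse_indices_UNIV)
  then have "inj_on (tensor_wavelet \<psi>) ?I"
    using inj_on_tensor_wavelet[OF assms] inj_on_subset by blast
  then show "card (sparse_set \<psi> k :: (real ^ 'n \<Rightarrow> real) set) = sparse_count CARD('n) k"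
    using I by (simp add: sparse_set_eq card_image)
qed

text \<open>The index is shifted by one: \<open>sparse_poly d\<close> belongs to dimension \<open>d + 1\<close>.\<close>

fun sparse_poly :: "nat \<Rightarrow> nat \<Rightarrow> real" where
  "sparse_poly 0 k = 2"
| "sparse_poly (Suc d) k = sparse_poly d k + (\<Sum>i\<le>k. sparse_poly d i)"

text \<open>The powers of two of level \<open>j\<close> and of the remaining budget
  \<open>k - j\<close> always multiply to \<open>2 ^ k\<close>. The surplus at level 0 doubles the
  term \<open>j = 0\<close>, which explains the extra summand \<open>sparse_poly d k\<close> in the
  recursion.\<close>

lemma sparse_count_Suc: "real (sparse_count (Suc d) k) = 6 ^ Suc d * 2 ^ k * sparse_poly d k"
proof (induction d arbitrary: k)
  case 0
  then show ?case by (simp add: sum_card_wavelet_index del: of_nat_sum)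
next
  case (Suc d)
  let ?C = "6 ^ Suc d :: real"
  have "real (sparse_count (Suc (Suc d)) k)
      = (\<Sum>j\<le>k. real (card (wavelet_index j)) * (?C * 2 ^ (k - j) * sparse_poly d (k - j)))"
    by (subst sparse_count.simps(2)) (simp only: of_nat_sum of_nat_mult Suc.IH)
  also have "\<dots> = (\<Sum>j\<le>k. 6 * ?C * 2 ^ k * sparse_poly d (k - j)
      + (if j = 0 then 6 * ?C * 2 ^ k * sparse_poly d k else 0))"
  proof (rule sum.cong[OF refl])
    fix j assume "j \<in> {..k}"
    then have "(2::real) ^ k = 2 ^ j * 2 ^ (k - j)" by (simp flip: power_add)
    then show "real (card (wavelet_index j)) * (?C * 2 ^ (k - j) * sparse_poly d (k - j))
      = 6 * ?C * 2 ^ k * sparse_poly d (k - j)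
        + (if j = 0 then 6 * ?C * 2 ^ k * sparse_poly d k else 0)"
      by (cases "j = 0") (simp_all add: card_wavelet_index)
  qed
  also have "\<dots> = 6 * ?C * 2 ^ k * (\<Sum>j\<le>k. sparse_poly d (k - j))
      + 6 * ?C * 2 ^ k * sparse_poly d k"
    by (simp add: sum.distrib sum_distrib_left)
  also have "(\<Sum>j\<le>k. sparse_poly d (k - j)) = (\<Sum>i\<le>k. sparse_poly d i)"
    using sum.nat_diff_reindex[of "sparse_poly d" "Suc k"] by (simp add: lessThan_Suc_atMost)
  finally show ?case by (simp add: algebra_simps)
qed

section \<open>Growth for fixed dimension\<close>

text \<open>The recursion adds \<open>k + 2\<close> terms, each at most the bound at
  \<open>k\<close>, and \<open>k + 2 \<le> 2 * (k + 1)\<close>: each dimension costs a factor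
  \<open>2 * (k + 1)\<close>.\<close>

lemma sparse_poly_le: "sparse_poly d k \<le> 2 ^ Suc d * (real k + 1) ^ d"
proof (induction d arbitrary: k)
  case 0
  then show ?case by simp
next
  case (Suc d)
  let ?B = "2 ^ Suc d * (real k + 1) ^ d"
  have "(\<Sum>i\<le>k. sparse_poly d i) \<le> (\<Sum>i\<le>k. ?B)"
  proof (rule sum_mono)
    fix i assume "i \<in> {..k}"
    then have "2 ^ Suc d * (real i + 1) ^ d \<le> ?B"
      by (intro mult_left_mono power_mono) auto
    with Suc.IH[of i] show "sparse_poly d i \<le> ?B" by linarith
  qed
  also have "\<dots> = (real k + 1) * ?B" by simp
  finally have "sparse_poly (Suc d) k \<le> ?B + (real k + 1) * ?B"
    using Suc.IH[of k] by simp
  also have "\<dots> \<le> (real k + 1) * ?B + (real k + 1) * ?B"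
    by (intro add_right_mono) (simp add: distrib_right)
  also have "\<dots> = 2 ^ Suc (Suc d) * (real k + 1) ^ Suc d" by simp
  finally show ?case .
qed

lemma sparse_count_bigo: "(\<lambda>k. real (sparse_count (Suc d) k)) \<in> O(\<lambda>k. 2 ^ k * real k ^ d)"
\<comment> \<open>The factors come from the normalisation in \<open>sparse_count_Suc\<close>, from
  \<open>sparse_poly_le\<close>, and from \<open>k + 1 \<le> 2 * k\<close>, which needs
  \<open>k \<ge> 1\<close>.\<close>
proof (rule bigoI[where c = "6 ^ Suc d * 2 ^ Suc d * 2 ^ d"])
  show "\<forall>\<^sub>F k in sequentially. norm (real (sparse_count (Suc d) k))
      \<le> 6 ^ Suc d * 2 ^ Suc d * 2 ^ d * norm (2 ^ k * real k ^ d)"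
    using eventually_ge_at_top[of 1]
  proof eventually_elim
    case (elim k)
    have "(real k + 1) ^ d \<le> (2 * real k) ^ d"
      using elim by (intro power_mono) auto
    then have "sparse_poly d k \<le> 2 ^ Suc d * (2 * real k) ^ d"
      by (intro order_trans[OF sparse_poly_le] mult_left_mono) auto
    then have "6 ^ Suc d * 2 ^ k * sparse_poly d k
        \<le> 6 ^ Suc d * 2 ^ k * (2 ^ Suc d * (2 * real k) ^ d)"
      by (intro mult_left_mono) auto
    also have "\<dots> = 6 ^ Suc d * 2 ^ Suc d * 2 ^ d * norm (2 ^ k * real k ^ d)"
      by (simp add: power_mult_distrib)
    finally show ?case
      by (simp only: real_norm_def abs_of_nat flip: sparse_count_Suc)
  qed
qed

section \<open>Closed forms for dimensions 2 to 5\<close>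

lemma sparse_poly_1: "sparse_poly 1 k = 2 * (real k + 2)"
  by simp

lemma sparse_poly_2: "sparse_poly 2 k = real k ^ 2 + 7 * real k + 8"
proof -
  \<comment> \<open>The right-hand side is the claimed polynomial minus
    \<open>sparse_poly 1 k\<close>, as the recursion demands; the next two lemmas proceed
    alike.\<close>
  have "(\<Sum>i\<le>k. sparse_poly 1 i) = real k ^ 2 + 5 * real k + 4"
    unfolding sparse_poly_1 by (induction k) (simp_all add: power2_eq_square algebra_simps)
  then show ?thesis
    using sparse_poly.simps(2)[of 1 k] by (simp add: sparse_poly_1 numeral_2_eq_2)
qed

lemma sparse_poly_3:
  "sparse_poly 3 k = 2 * (real k ^ 3 / 6 + 5 * real k ^ 2 / 2 + 28 * real k / 3 + 8)"
proof -
  have "(\<Sum>i\<le>k. sparse_poly 2 i) = real k ^ 3 / 3 + 4 * real k ^ 2 + 35 * real k / 3 + 8"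
    unfolding sparse_poly_2
    by (induction k) (simp_all add: power2_eq_square power3_eq_cube field_simps)
  then show ?thesis
    using sparse_poly.simps(2)[of 2 k] by (simp add: sparse_poly_2 flip: numeral_3_eq_3)
qed

lemma sparse_poly_4:
  "sparse_poly 4 k = 2 * (real k ^ 4 / 24 + 13 * real k ^ 3 / 12 + 203 * real k ^ 2 / 24
     + 269 * real k / 12 + 16)"
proof -
  have "(\<Sum>i\<le>k. sparse_poly 3 i)
      = real k ^ 4 / 12 + 11 * real k ^ 3 / 6 + 143 * real k ^ 2 / 12 + 157 * real k / 6 + 16"
    unfolding sparse_poly_3
    by (induction k) (simp_all add: eval_nat_numeral field_simps)
  moreover have "sparse_poly 4 k = sparse_poly 3 k + (\<Sum>i\<le>k. sparse_poly 3 i)"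
    using sparse_poly.simps(2)[of 3 k] by simp
  ultimately show ?thesis by (simp add: sparse_poly_3)
qed

text \<open>The exponent in the anisotropic count is \<open>d * (k + 1)\<close>, since levels 0 to
  \<open>k\<close> are all included; \<open>6 ^ d * 2 ^ (d * k)\<close> would be too small. Already
  \<open>d = k = 1\<close> gives 12 + 12 = 24 functions. The order of growth is unaffected.\<close>

theorem lemma10:
  fixes \<psi> :: "nat \<Rightarrow> int \<Rightarrow> real \<Rightarrow> real"
    and \<Psi> \<Psi>ani :: "nat \<Rightarrow> (real ^ 'n::finite \<Rightarrow> real) set"
    and d :: nat
  assumes "orthonormal_wavelet_system \<psi>"
    and "\<Psi> = sparse_set \<psi>" and "\<Psi>ani = anisotropic_set \<psi>"
    and "CARD('n) = d"
  shows "(\<forall>k\<ge>1. finite (\<Psi>ani k) \<and> card (\<Psi>ani k) = 6 ^ d * 2 ^ (d * (k + 1)))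
    \<and> (\<lambda>k. real (card (\<Psi>ani k))) \<in> O(\<lambda>k. 2 ^ (d * k))
    \<and> (\<forall>k\<ge>1. finite (\<Psi> k))
    \<and> (\<lambda>k. real (card (\<Psi> k))) \<in> O(\<lambda>k. 2 ^ k * real k ^ (d - 1))
    \<and> (d = 2 \<longrightarrow> (\<forall>k\<ge>1. card (\<Psi> k) = 6\<^sup>2 * (k + 2) * 2 ^ (k + 1)))
    \<and> (d = 3 \<longrightarrow> (\<forall>k\<ge>1. card (\<Psi> k) = 6 ^ 3 * (k\<^sup>2 + 7 * k + 8) * 2 ^ k))
    \<and> (d = 4 \<longrightarrow> (\<forall>k\<ge>1. real (card (\<Psi> k)) =
          6 ^ 4 * (real k ^ 3 / 6 + 5 * real k ^ 2 / 2 + 28 * real k / 3 + 8) * 2 ^ (k + 1)))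
    \<and> (d = 5 \<longrightarrow> (\<forall>k\<ge>1. real (card (\<Psi> k)) =
          6 ^ 5 * (real k ^ 4 / 24 + 13 * real k ^ 3 / 12 + 203 * real k ^ 2 / 24
            + 269 * real k / 12 + 16) * 2 ^ (k + 1)))"
proof -
  \<comment> \<open>An index type is nonempty, so \<open>d - 1\<close> is a genuine
    predecessor.\<close>
  have "0 < d" using assms(4) by (metis zero_less_card_finite)
  then obtain e where e: "d = Suc e" by (cases d) auto
  have ani: "finite (\<Psi>ani k)" "card (\<Psi>ani k) = 6 ^ d * 2 ^ (d * (k + 1))" for k
    using finite_card_anisotropic_set[OF assms(1), where 'n = 'n] assms(3,4) by auto
  have sparse: "finite (\<Psi> k)" "card (\<Psi> k) = sparse_count d k" for k
    using finite_card_sparse_set[OF assms(1), where 'n = 'n] assms(2,4) by auto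
  have real_card: "real (card (\<Psi> k)) = 6 ^ Suc e * 2 ^ k * sparse_poly e k" for k
    unfolding sparse(2) e by (rule sparse_count_Suc)
  have "real (card (\<Psi>ani k)) = (6 ^ d * 2 ^ d) * 2 ^ (d * k)" for k
    by (simp add: ani(2) power_add)
  then have ani_bigo: "(\<lambda>k. real (card (\<Psi>ani k))) \<in> O(\<lambda>k. 2 ^ (d * k))"
    by simp
  have sparse_bigo: "(\<lambda>k. real (card (\<Psi> k))) \<in> O(\<lambda>k. 2 ^ k * real k ^ (d - 1))"
    using sparse_count_bigo[of e] by (simp add: sparse(2) e)
  have d2: "card (\<Psi> k) = 6\<^sup>2 * (k + 2) * 2 ^ (k + 1)" if "d = 2" for k
  proof -
    have "e = 1" using that e by simp
    then have "real (card (\<Psi> k)) = real (6\<^sup>2 * (k + 2) * 2 ^ (k + 1))"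
      unfolding real_card by (simp add: sparse_poly_1[unfolded One_nat_def] algebra_simps)
    \<comment> \<open>The identity is proved over the reals, where \<open>sparse_poly\<close> takes
      its values, and carried back to the naturals.\<close>
    then show ?thesis by (simp only: of_nat_eq_iff)
  qed
  have d3: "card (\<Psi> k) = 6 ^ 3 * (k\<^sup>2 + 7 * k + 8) * 2 ^ k" if "d = 3" for k
  proof -
    have "e = 2" using that e by simp
    then have "real (card (\<Psi> k)) = real (6 ^ 3 * (k\<^sup>2 + 7 * k + 8) * 2 ^ k)"
      unfolding real_card by (simp add: sparse_poly_2)
    then show ?thesis by (simp only: of_nat_eq_iff)
  qed
  have d4: "real (card (\<Psi> k)) =
      6 ^ 4 * (real k ^ 3 / 6 + 5 * real k ^ 2 / 2 + 28 * real k / 3 + 8) * 2 ^ (k + 1)"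
    if "d = 4" for k
  proof -
    have "e = 3" using that e by simp
    then show ?thesis unfolding real_card by (simp add: sparse_poly_3)
  qed
  have d5: "real (card (\<Psi> k)) =
      6 ^ 5 * (real k ^ 4 / 24 + 13 * real k ^ 3 / 12 + 203 * real k ^ 2 / 24
        + 269 * real k / 12 + 16) * 2 ^ (k + 1)"
    if "d = 5" for k
  proof -
    have "e = 4" using that e by simp
    then show ?thesis unfolding real_card by (simp add: sparse_poly_4)
  qed
  show ?thesis
    using ani sparse(1) ani_bigo sparse_bigo d2 d3 d4 d5 by blast
qed

end
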